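(* Let $\varphi$ be a (possibly constant) linear-fractional selfmap of the open unit disk $\mathbb{D}$. If the composition operator $C_\varphi$ is posinormal on $H^2$, then $\varphi(\beta)=0$ for some $\beta\in\mathbb{D}$.
   Context: $H^2$ is the Hilbert space of analytic functions $f(z)=\sum_{n\ge 0}a_nz^n$ on $\mathbb{D}$ with $\|f\|^2=\sum|a_n|^2<\infty$, and $C_\varphi f=f\circ\varphi$ (bounded on $H^2$). A linear-fractional selfmap of $\mathbb{D}$ is a map $\varphi(z)=\frac{az+b}{cz+d}$ with $\varphi(\mathbb{D})\subseteq\mathbb{D}$; constant maps are allowed here. A bounded linear operator $A$ on a Hilbert space is posinormal if there is a positive operator $P$ with $AA^*=A^*PA$ (equivalently, $\operatorname{ran}A\subseteq\operatorname{ran}A^*$). *)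

theory Defs
  imports "HOL-Complex_Analysis.Complex_Analysis"
begin

abbreviation unit_disk :: "complex set" where
  "unit_disk \<equiv> ball 0 1"

abbreviation taylor_coeff :: "(complex \<Rightarrow> complex) \<Rightarrow> nat \<Rightarrow> complex" where
  "taylor_coeff f n \<equiv> fps_nth (fps_expansion f 0) n"

text \<open>
  An element of \<open>H\<^sup>2\<close> is a function on the unit disk. It is represented here by its extension
  by zero, so that equality of elements is HOL equality and the pointwise vector space
  operations of \<^typ>\<open>complex \<Rightarrow> complex\<close> are those of \<open>H\<^sup>2\<close>.
\<close>

definition hardy :: "(complex \<Rightarrow> complex) set" where
  "hardy = {f. f holomorphic_on unit_disk \<and>
               summable (\<lambda>n. (cmod (taylor_coeff f n))\<^sup>2) \<and>
               (\<forall>z. z \<notin> unit_disk \<longrightarrow> f z = 0)}"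

definition hardy_inner :: "(complex \<Rightarrow> complex) \<Rightarrow> (complex \<Rightarrow> complex) \<Rightarrow> complex" where
  "hardy_inner f g = (\<Sum>n. taylor_coeff f n * cnj (taylor_coeff g n))"

definition hardy_norm :: "(complex \<Rightarrow> complex) \<Rightarrow> real" where
  "hardy_norm f = sqrt (\<Sum>n. (cmod (taylor_coeff f n))\<^sup>2)"

text \<open>
  Operators on \<open>H\<^sup>2\<close> are functions on \<^typ>\<open>complex \<Rightarrow> complex\<close> of which only the restriction
  to \<^const>\<open>hardy\<close> is relevant.
\<close>

definition bounded_operator ::
    "((complex \<Rightarrow> complex) \<Rightarrow> (complex \<Rightarrow> complex)) \<Rightarrow> bool" where
  "bounded_operator A \<longleftrightarrow>
     A ` hardy \<subseteq> hardy \<and>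
     (\<forall>f\<in>hardy. \<forall>g\<in>hardy. A (\<lambda>z. f z + g z) = (\<lambda>z. A f z + A g z)) \<and>
     (\<forall>c. \<forall>f\<in>hardy. A (\<lambda>z. c * f z) = (\<lambda>z. c * A f z)) \<and>
     (\<exists>K. \<forall>f\<in>hardy. hardy_norm (A f) \<le> K * hardy_norm f)"

text \<open>
  The adjoint is a relation because its uniqueness (and, by the Riesz representation theorem,
  its existence for bounded \<open>A\<close>) only concerns its values on \<^const>\<open>hardy\<close>.
\<close>

definition is_adjoint ::
    "((complex \<Rightarrow> complex) \<Rightarrow> (complex \<Rightarrow> complex)) \<Rightarrow>
     ((complex \<Rightarrow> complex) \<Rightarrow> (complex \<Rightarrow> complex)) \<Rightarrow> bool" where
  "is_adjoint A B \<longleftrightarrow>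
     bounded_operator B \<and>
     (\<forall>f\<in>hardy. \<forall>g\<in>hardy. hardy_inner (A f) g = hardy_inner f (B g))"

definition positive_operator ::
    "((complex \<Rightarrow> complex) \<Rightarrow> (complex \<Rightarrow> complex)) \<Rightarrow> bool" where
  "positive_operator P \<longleftrightarrow>
     bounded_operator P \<and> (\<forall>f\<in>hardy. hardy_inner (P f) f \<in> \<real>\<^sub>\<ge>\<^sub>0)"

definition posinormal ::
    "((complex \<Rightarrow> complex) \<Rightarrow> (complex \<Rightarrow> complex)) \<Rightarrow> bool" where
  "posinormal A \<longleftrightarrow>
     bounded_operator A \<and>
     (\<exists>B P. is_adjoint A B \<and> positive_operator P \<and>
            (\<forall>f\<in>hardy. A (B f) = B (P (A f))))"

definition composition_operator ::
    "(complex \<Rightarrow> complex) \<Rightarrow> (complex \<Rightarrow> complex) \<Rightarrow> (complex \<Rightarrow> complex)" where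
  "composition_operator \<phi> f = (\<lambda>z. if z \<in> unit_disk then f (\<phi> z) else 0)"

text \<open>
  No condition \<open>a * d - b * c \<noteq> 0\<close> is imposed, so constant maps are included. The denominator
  must not vanish on the disk, since HOL division by zero would otherwise give the value 0.
  Nothing is required of \<open>\<phi>\<close> outside the disk.
\<close>

definition linear_fractional_selfmap :: "(complex \<Rightarrow> complex) \<Rightarrow> bool" where
  "linear_fractional_selfmap \<phi> \<longleftrightarrow>
     (\<exists>a b c d. \<forall>z\<in>unit_disk. c * z + d \<noteq> 0 \<and> \<phi> z = (a * z + b) / (c * z + d)) \<and>
     \<phi> ` unit_disk \<subseteq> unit_disk"

end

theory Submission
  imports Defs
begin

text \<open>
  If \<open>C\<close> is the composition operator and \<open>C B = B P C\<close> with adjoint \<open>B\<close>, then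
  \<open>\<parallel>B f\<parallel>\<^sup>2 = \<langle>C B f, f\<rangle> = \<langle>P C f, C f\<rangle>\<close> is at most a constant times \<open>\<parallel>C f\<parallel>\<^sup>2\<close>, and therefore so is
  \<open>\<bar>f 0\<bar>\<^sup>2 = \<bar>B f 0\<bar>\<^sup>2\<close>. If \<open>\<phi>\<close> has no zero in the disk, the image of \<open>\<phi>\<close> is a disk (or a point)
  with 0 not in its interior, and with center \<open>p / 2\<close>, say. The function \<open>1 - z / p\<close> has the value 1
  at 0, and its modulus is less than 1 on the closure of the image except possibly at 0.
  Its powers \<open>f\<close> satisfy \<open>f 0 = 1\<close> although \<open>\<parallel>C f\<parallel>\<close> tends to 0, by Bessel's inequality on the unit
  circle and dominated convergence. This is a contradiction.
\<close>

section \<open>Taylor coefficients and Bessel's inequality on the unit circle\<close>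

lemma taylor_coeff_cong:
  assumes "\<And>z. z \<in> unit_disk \<Longrightarrow> f z = g z"
  shows "taylor_coeff f n = taylor_coeff g n"
proof -
  have "eventually (\<lambda>z. f z = g z) (nhds 0)"
    using assms by (intro eventually_nhds_in_open[THEN eventually_mono, of unit_disk]) auto
  then show ?thesis
    by (simp add: fps_expansion_cong)
qed

lemma taylor_coeff_0 [simp]: "taylor_coeff f 0 = f 0"
  by (simp add: fps_expansion_def)

lemma taylor_coeff_polynomial:
  "taylor_coeff (\<lambda>z. \<Sum>n<N. c n * z ^ n) m = (if m < N then c m else 0)"
proof -
  have "(\<lambda>z. \<Sum>n<N. c n * z ^ n) has_fps_expansion (\<Sum>n<N. fps_const (c n) * fps_X ^ n)"
    by (intro fps_expansion_intros)
  then show ?thesis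
    by (simp add: fps_expansion_eqI fps_sum_nth if_distrib cong: if_cong)
qed

lemma norm_circlepath_0_1: "cmod (circlepath 0 1 t) = 1"
  by (simp add: circlepath)

lemma continuous_on_circlepath: "continuous_on S (circlepath 0 1)"
  unfolding circlepath by (intro continuous_intros)

text \<open>Cauchy's formula holds on the unit circle itself by continuity up to the boundary. There
  dz = 2 pi i z dt cancels the constant and one power of z, and 1 / z^n is the conjugate of z^n, so
  Taylor coefficients are Fourier coefficients.\<close>

lemma has_integral_taylor_coeff:
  assumes "continuous_on (cball 0 1) h" "h holomorphic_on unit_disk"
  shows "((\<lambda>t. h (circlepath 0 1 t) * cnj (circlepath 0 1 t ^ n)) has_integral taylor_coeff h n) {0..1}"
proof -
  have "((\<lambda>u. h u / (u - 0) ^ Suc n) has_contour_integral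
          (2 * pi * \<i>) / fact n * (deriv ^^ n) h 0) (circlepath 0 1)"
    by (rule Cauchy_has_contour_integral_higher_derivative_circlepath) (use assms in auto)
  then have "((\<lambda>t. h (circlepath 0 1 t) / (circlepath 0 1 t - 0) ^ Suc n *
       vector_derivative (circlepath 0 1) (at t within {0..1})) has_integral
          (2 * pi * \<i>) / fact n * (deriv ^^ n) h 0) {0..1}"
    unfolding has_contour_integral_def .
  then have "((\<lambda>t. inverse (2 * pi * \<i>) * (h (circlepath 0 1 t) / (circlepath 0 1 t - 0) ^ Suc n *
       vector_derivative (circlepath 0 1) (at t within {0..1}))) has_integral
          inverse (2 * pi * \<i>) * ((2 * pi * \<i>) / fact n * (deriv ^^ n) h 0)) {0..1}"
    by (rule has_integral_mult_right)
  moreover have "inverse (2 * pi * \<i>) * (h (circlepath 0 1 t) / (circlepath 0 1 t - 0) ^ Suc n *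
       vector_derivative (circlepath 0 1) (at t within {0..1}))
       = h (circlepath 0 1 t) * cnj (circlepath 0 1 t ^ n)" if "t \<in> {0..1}" for t
  proof -
    define w where "w = circlepath 0 1 t"
    have w: "cmod w = 1" "w \<noteq> 0"
      using norm_circlepath_0_1[of t] by (auto simp: w_def)
    have deriv: "vector_derivative (circlepath 0 1) (at t within {0..1}) = 2 * pi * \<i> * w"
      using vector_derivative_circlepath01[of t 0 1] that by (simp add: w_def circlepath[of 0 1])
    have "cnj w = inverse w"
      using w complex_norm_square[of w] by (simp add: inverse_unique)
    then have cnj_power: "cnj (w ^ n) = inverse (w ^ n)"
      by (simp add: power_inverse)
    have "inverse k * (y / (w - 0) ^ Suc n * (k * w)) = y * inverse (w ^ n)" if "k \<noteq> 0" for k y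
      using w that by (simp add: field_simps)
    from this[of "2 * pi * \<i>" "h w"] show ?thesis
      unfolding w_def[symmetric] deriv cnj_power by simp
  qed
  ultimately have "((\<lambda>t. h (circlepath 0 1 t) * cnj (circlepath 0 1 t ^ n)) has_integral
          inverse (2 * pi * \<i>) * ((2 * pi * \<i>) / fact n * (deriv ^^ n) h 0)) {0..1}"
    by (rule has_integral_eq[rotated])
  moreover have "inverse k * (k / fact n * y) = y / fact n" if "k \<noteq> 0" for k y :: complex
    using that by simp
  from this[of "2 * pi * \<i>"]
  have "inverse (2 * pi * \<i>) * ((2 * pi * \<i>) / fact n * (deriv ^^ n) h 0) = taylor_coeff h n"
    by (simp add: fps_expansion_def)
  ultimately show ?thesis
    by (simp only:)
qed

text \<open>With \<open>q\<close> the Taylor polynomial of \<open>h\<close>, both <h, q> and <q, q>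
  on the circle equal the sum on the left, which is therefore the integral of |h|^2 - |h -
  q|^2.\<close>

lemma bessel_taylor_coeff:
  assumes cont: "continuous_on (cball 0 1) h" and hol: "h holomorphic_on unit_disk"
  shows "(\<Sum>n<N. (cmod (taylor_coeff h n))\<^sup>2) \<le> integral {0..1} (\<lambda>t. (cmod (h (circlepath 0 1 t)))\<^sup>2)"
proof -
  define E where "E = circlepath 0 1"
  define c where "c = taylor_coeff h"
  define q where "q = (\<lambda>z. \<Sum>n<N. c n * z ^ n)"
  have E: "cmod (E t) = 1" "E t \<in> cball 0 1" for t
    using norm_circlepath_0_1[of t] by (auto simp: E_def)
  have contE: "continuous_on {0..1} E"
    by (simp add: E_def continuous_on_circlepath)
  have conth: "continuous_on {0..1} (\<lambda>t. h (E t))"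
    by (rule continuous_on_compose2[OF cont contE]) (use E in auto)
  have contq: "continuous_on A q" for A
    unfolding q_def by (intro continuous_intros)
  \<comment> \<open>The coefficient formula for the polynomial \<open>q\<close> itself takes the
    place of the orthogonality of the monomials.\<close>
  have coeffq: "((\<lambda>t. q (E t) * cnj (E t ^ n)) has_integral c n) {0..1}" if "n < N" for n
    using has_integral_taylor_coeff[of q n, OF contq] that
    by (simp add: taylor_coeff_polynomial q_def E_def holomorphic_intros)
  have coeffh: "((\<lambda>t. h (E t) * cnj (E t ^ n)) has_integral c n) {0..1}" for n
    using has_integral_taylor_coeff[OF cont hol] by (simp add: E_def c_def)
  have "((\<lambda>t. \<Sum>n<N. cnj (c n) * (h (E t) * cnj (E t ^ n))) has_integral (\<Sum>n<N. cnj (c n) * c n)) {0..1}"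
    by (intro has_integral_sum has_integral_mult_right coeffh) auto
  then have hq: "((\<lambda>t. h (E t) * cnj (q (E t))) has_integral (\<Sum>n<N. cnj (c n) * c n)) {0..1}"
    by (simp add: q_def sum_distrib_left mult_ac)
  have "((\<lambda>t. \<Sum>n<N. cnj (c n) * (q (E t) * cnj (E t ^ n))) has_integral (\<Sum>n<N. cnj (c n) * c n)) {0..1}"
    by (intro has_integral_sum has_integral_mult_right coeffq) auto
  then have qq: "((\<lambda>t. q (E t) * cnj (q (E t))) has_integral (\<Sum>n<N. cnj (c n) * c n)) {0..1}"
    by (subst (2) q_def) (simp add: sum_distrib_left mult_ac)
  have eq: "2 * Re (h z * cnj (q z)) - Re (q z * cnj (q z)) = (cmod (h z))\<^sup>2 - (cmod (h z - q z))\<^sup>2" for z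
    unfolding cmod_power2 by (simp add: power2_eq_square algebra_simps)
  have "((\<lambda>t. 2 * Re (h (E t) * cnj (q (E t))) - Re (q (E t) * cnj (q (E t)))) has_integral
          2 * Re (\<Sum>n<N. cnj (c n) * c n) - Re (\<Sum>n<N. cnj (c n) * c n)) {0..1}"
    by (intro has_integral_diff has_integral_mult_right has_integral_linear[OF hq bounded_linear_Re, unfolded o_def]
          has_integral_linear[OF qq bounded_linear_Re, unfolded o_def])
  then have "((\<lambda>t. (cmod (h (E t)))\<^sup>2 - (cmod (h (E t) - q (E t)))\<^sup>2) has_integral
          Re (\<Sum>n<N. cnj (c n) * c n)) {0..1}"
    by (simp only: eq) simp
  moreover have "(\<lambda>t. (cmod (h (E t)))\<^sup>2) integrable_on {0..1}"
    by (intro integrable_continuous_interval continuous_intros conth)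
  ultimately have "Re (\<Sum>n<N. cnj (c n) * c n) \<le> integral {0..1} (\<lambda>t. (cmod (h (E t)))\<^sup>2)"
    by (rule has_integral_le[OF _ integrable_integral]) auto
  then show ?thesis
    unfolding cmod_power2[of "taylor_coeff h _"] by (simp add: c_def E_def power2_eq_square)
qed

section \<open>Powers of a peaking function in \<open>hardy\<close>\<close>

text \<open>The extension by zero through which \<open>hardy\<close> represents a function on the
  disk.\<close>

definition disk_restrict :: "(complex \<Rightarrow> complex) \<Rightarrow> complex \<Rightarrow> complex" where
  "disk_restrict h z = (if z \<in> unit_disk then h z else 0)"

lemma taylor_coeff_disk_restrict [simp]: "taylor_coeff (disk_restrict h) n = taylor_coeff h n"
  by (rule taylor_coeff_cong) (simp add: disk_restrict_def)

lemma disk_restrict_in_hardy: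
  assumes "continuous_on (cball 0 1) h" "h holomorphic_on unit_disk"
  shows "disk_restrict h \<in> hardy"
proof -
  have "disk_restrict h holomorphic_on unit_disk"
    using assms(2) by (rule holomorphic_transform) (simp add: disk_restrict_def)
  moreover have "summable (\<lambda>n. (cmod (taylor_coeff h n))\<^sup>2)"
    using bessel_taylor_coeff[OF assms]
    by (intro summableI_nonneg_bounded) auto
  ultimately show ?thesis
    by (simp add: hardy_def) (simp add: disk_restrict_def)
qed

lemma hardy_norm_disk_restrict_le:
  assumes "continuous_on (cball 0 1) h" "h holomorphic_on unit_disk"
  shows "(hardy_norm (disk_restrict h))\<^sup>2 \<le> integral {0..1} (\<lambda>t. (cmod (h (circlepath 0 1 t)))\<^sup>2)"
proof -
  have s: "summable (\<lambda>n. (cmod (taylor_coeff h n))\<^sup>2)"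
    using bessel_taylor_coeff[OF assms]
    by (intro summableI_nonneg_bounded) auto
  then have "(\<Sum>n. (cmod (taylor_coeff h n))\<^sup>2) \<le> integral {0..1} (\<lambda>t. (cmod (h (circlepath 0 1 t)))\<^sup>2)"
    using bessel_taylor_coeff[OF assms] by (intro suminf_le_const) auto
  then show ?thesis
    using s by (simp add: hardy_norm_def suminf_nonneg)
qed

text \<open>By \<open>unique\<close>, |g| reaches 1 at no more than one point of the circle, so
  |g^n|^2 tends to 0 almost everywhere there, dominated by 1.\<close>

lemma hardy_norm_powers_tendsto_0:
  assumes cont: "continuous_on (cball 0 1) g" and hol: "g holomorphic_on unit_disk"
    and le: "\<And>z. cmod z = 1 \<Longrightarrow> cmod (g z) \<le> 1"
    and unique: "\<And>z w. cmod z = 1 \<Longrightarrow> cmod w = 1 \<Longrightarrow> cmod (g z) = 1 \<Longrightarrow> cmod (g w) = 1 \<Longrightarrow> z = w"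
  shows "(\<lambda>n. hardy_norm (disk_restrict (\<lambda>z. g z ^ n))) \<longlonglongrightarrow> 0"
proof -
  define E where "E = circlepath 0 1"
  define S where "S = {t \<in> {0..1}. cmod (g (E t)) = 1}"
  have E: "cmod (E t) = 1" for t
    using norm_circlepath_0_1[of t] by (auto simp: E_def)
  have contg: "continuous_on {0..1} (\<lambda>t. g (E t))"
    by (rule continuous_on_compose2[OF cont]) (use E in \<open>auto simp: E_def continuous_on_circlepath\<close>)
  have "finite S"
  proof (cases "S = {}")
    case False
    then obtain s where s: "s \<in> S" by auto
    have "loop_free E"
      using simple_path_circlepath[of 0 1] by (simp add: E_def simple_path_def)
    moreover have "E t = E s" if "t \<in> S" for t
      using that s unique E by (simp add: S_def)
    \<comment> \<open>The circle closes up at the parameters 0 and 1, so \<open>loop_free\<close>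
      gives \<open>t = s\<close> only up to this pair.\<close>
    ultimately have "t \<in> {s, 0, 1}" if "t \<in> S" for t
      using that s unfolding loop_free_def S_def by blast
    then have "S \<subseteq> {s, 0, 1}" by blast
    then show ?thesis by (rule finite_subset) simp
  qed simp
  have "(\<lambda>n. integral {0..1} (\<lambda>t. (cmod (g (E t) ^ n))\<^sup>2)) \<longlonglongrightarrow>
          integral {0..1} (\<lambda>t. if t \<in> S then 1 else 0)"
  proof (rule dominated_convergence(2)[where h = "\<lambda>_. 1"])
    fix n
    show "(\<lambda>t. (cmod (g (E t) ^ n))\<^sup>2) integrable_on {0..1}"
      by (intro integrable_continuous_interval continuous_intros contg)
  next
    fix n and t :: real
    show "norm ((cmod (g (E t) ^ n))\<^sup>2) \<le> 1"
      using le[OF E] by (simp add: norm_power power_le_one)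
  next
    fix t :: real assume t: "t \<in> {0..1}"
    show "(\<lambda>n. (cmod (g (E t) ^ n))\<^sup>2) \<longlonglongrightarrow> (if t \<in> S then 1 else 0)"
    proof (cases "t \<in> S")
      case False
      then have "cmod (g (E t)) < 1"
        using t le[OF E, of t] by (auto simp: S_def)
      then have "(\<lambda>n. cmod (g (E t)) ^ n) \<longlonglongrightarrow> 0"
        by (intro LIMSEQ_realpow_zero) auto
      from tendsto_power[OF this, of 2] show ?thesis
        using False by (simp add: norm_power)
    qed (simp add: S_def norm_power)
  qed auto
  also have "integral {0..1} (\<lambda>t. if t \<in> S then 1 else 0::real) = integral {0..1} (\<lambda>t::real. 0::real)"
    using negligible_finite[OF \<open>finite S\<close>] by (rule integral_spike) auto
  finally have lim: "(\<lambda>n. integral {0..1} (\<lambda>t. (cmod (g (E t) ^ n))\<^sup>2)) \<longlonglongrightarrow> 0"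
    by simp
  have bound: "(hardy_norm (disk_restrict (\<lambda>z. g z ^ n)))\<^sup>2 \<le> integral {0..1} (\<lambda>t. (cmod (g (E t) ^ n))\<^sup>2)" for n
    unfolding E_def by (intro hardy_norm_disk_restrict_le continuous_intros holomorphic_intros cont hol)
  have "(\<lambda>n. (hardy_norm (disk_restrict (\<lambda>z. g z ^ n)))\<^sup>2) \<longlonglongrightarrow> 0"
    by (intro tendsto_sandwich[OF _ _ tendsto_const lim] always_eventually allI zero_le_power2 bound)
  then show ?thesis
    by simp
qed

section \<open>The inner product of \<open>hardy\<close>\<close>

text \<open>The finite inequality bounds all partial sums of |a n * b n| by the same constant, which
  yields absolute convergence and the estimate together.\<close>

lemma cauchy_schwarz_suminf:
  fixes a b :: "nat \<Rightarrow> complex"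
  assumes a: "summable (\<lambda>n. (cmod (a n))\<^sup>2)" and b: "summable (\<lambda>n. (cmod (b n))\<^sup>2)"
  shows "summable (\<lambda>n. a n * b n)"
    and "cmod (\<Sum>n. a n * b n) \<le> sqrt (\<Sum>n. (cmod (a n))\<^sup>2) * sqrt (\<Sum>n. (cmod (b n))\<^sup>2)"
proof -
  have le: "(\<Sum>n<N. cmod (a n * b n)) \<le> sqrt (\<Sum>n. (cmod (a n))\<^sup>2) * sqrt (\<Sum>n. (cmod (b n))\<^sup>2)" for N
  proof -
    have "(\<Sum>n<N. cmod (a n * b n)) \<le> L2_set (\<lambda>n. cmod (a n)) {..<N} * L2_set (\<lambda>n. cmod (b n)) {..<N}"
      using L2_set_mult_ineq[of "\<lambda>n. cmod (a n)" "\<lambda>n. cmod (b n)" "{..<N}"] by (simp add: norm_mult)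
    also have "\<dots> \<le> sqrt (\<Sum>n. (cmod (a n))\<^sup>2) * sqrt (\<Sum>n. (cmod (b n))\<^sup>2)"
      unfolding L2_set_def
      by (intro mult_mono real_sqrt_le_mono sum_le_suminf a b real_sqrt_ge_zero suminf_nonneg sum_nonneg) auto
    finally show ?thesis .
  qed
  have s: "summable (\<lambda>n. cmod (a n * b n))"
    using le by (intro summableI_nonneg_bounded) auto
  then show "summable (\<lambda>n. a n * b n)"
    by (rule summable_norm_cancel)
  have "cmod (\<Sum>n. a n * b n) \<le> (\<Sum>n. cmod (a n * b n))"
    using s by (rule summable_norm)
  also have "\<dots> \<le> sqrt (\<Sum>n. (cmod (a n))\<^sup>2) * sqrt (\<Sum>n. (cmod (b n))\<^sup>2)"
    using s le by (intro suminf_le_const) auto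
  finally show "cmod (\<Sum>n. a n * b n) \<le> sqrt (\<Sum>n. (cmod (a n))\<^sup>2) * sqrt (\<Sum>n. (cmod (b n))\<^sup>2)" .
qed

lemma hardy_cauchy_schwarz:
  assumes "f \<in> hardy" "g \<in> hardy"
  shows "cmod (hardy_inner f g) \<le> hardy_norm f * hardy_norm g"
  using cauchy_schwarz_suminf(2)[of "taylor_coeff f" "\<lambda>n. cnj (taylor_coeff g n)"] assms
  by (simp add: hardy_def hardy_inner_def hardy_norm_def)

lemma hardy_inner_commute:
  assumes "f \<in> hardy" "g \<in> hardy"
  shows "hardy_inner g f = cnj (hardy_inner f g)"
proof -
  have "summable (\<lambda>n. taylor_coeff f n * cnj (taylor_coeff g n))"
    using assms by (intro cauchy_schwarz_suminf(1)) (auto simp: hardy_def)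
  then have "(\<lambda>n. cnj (taylor_coeff f n * cnj (taylor_coeff g n))) sums cnj (hardy_inner f g)"
    unfolding hardy_inner_def by (intro sums_cnj[THEN iffD2] summable_sums)
  then show ?thesis
    unfolding hardy_inner_def[of g f] by (auto simp: sums_iff mult.commute)
qed

lemma hardy_inner_self:
  assumes "f \<in> hardy"
  shows "hardy_inner f f = (hardy_norm f)\<^sup>2"
proof -
  have "summable (\<lambda>n. (cmod (taylor_coeff f n))\<^sup>2)"
    using assms by (simp add: hardy_def)
  then show ?thesis
    by (simp add: hardy_inner_def hardy_norm_def suminf_nonneg complex_norm_square[symmetric] suminf_of_real
        del: of_real_power)
qed

lemma norm_at_0_le_hardy_norm:
  assumes "f \<in> hardy"
  shows "cmod (f 0) \<le> hardy_norm f"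
proof -
  have "(\<Sum>n<1. (cmod (taylor_coeff f n))\<^sup>2) \<le> (\<Sum>n. (cmod (taylor_coeff f n))\<^sup>2)"
    using assms by (intro sum_le_suminf) (auto simp: hardy_def)
  then show ?thesis
    unfolding hardy_norm_def by (intro real_le_rsqrt) simp
qed

text \<open>The constant 1 is the reproducing kernel at 0.\<close>

lemma hardy_inner_one: "hardy_inner (disk_restrict (\<lambda>_. 1)) f = cnj (f 0)"
proof -
  have "taylor_coeff (\<lambda>_. 1) n = (if n < 1 then 1 else 0)" for n
    using taylor_coeff_polynomial[of "\<lambda>_. 1" 1 n] by simp
  then have "hardy_inner (disk_restrict (\<lambda>_. 1)) f = (\<Sum>n. if n = 0 then cnj (f 0) else 0)"
    unfolding hardy_inner_def by (intro suminf_cong) auto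
  then show ?thesis
    using sums_If_finite_set[of "{0::nat}" "\<lambda>_. cnj (f 0)"] by (simp add: sums_iff)
qed

section \<open>Norm inequalities from posinormality\<close>

text \<open>By Douglas' factorization theorem, such an inequality is equivalent to ran A being
  contained in ran A*. Here \<open>K\<close> is a norm bound for \<open>P\<close>.\<close>

lemma posinormal_adjoint_bound:
  assumes "posinormal A"
  obtains B K where "is_adjoint A B"
    and "\<And>f. f \<in> hardy \<Longrightarrow> (hardy_norm (B f))\<^sup>2 \<le> K * (hardy_norm (A f))\<^sup>2"
proof -
  from assms obtain B P where A: "bounded_operator A" and B: "is_adjoint A B"
    and P: "bounded_operator P" and comm: "\<And>f. f \<in> hardy \<Longrightarrow> A (B f) = B (P (A f))"
    by (auto simp: posinormal_def positive_operator_def)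
  from P obtain K where K: "\<And>f. f \<in> hardy \<Longrightarrow> hardy_norm (P f) \<le> K * hardy_norm f"
    unfolding bounded_operator_def by blast
  have in_hardy: "A f \<in> hardy" "B f \<in> hardy" "P f \<in> hardy" if "f \<in> hardy" for f
    using A B P that by (auto simp: bounded_operator_def is_adjoint_def)
  have adj: "hardy_inner (A f) g = hardy_inner f (B g)" if "f \<in> hardy" "g \<in> hardy" for f g
    using B that by (simp add: is_adjoint_def)
  have "(hardy_norm (B f))\<^sup>2 \<le> K * (hardy_norm (A f))\<^sup>2" if f: "f \<in> hardy" for f
  proof -
    have "complex_of_real ((hardy_norm (B f))\<^sup>2) = hardy_inner (A (B f)) f"
      using f by (simp add: hardy_inner_self in_hardy adj)
    \<comment> \<open>The adjoint relation trades \<open>B\<close> in the second slot for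
      \<open>A\<close> in the first, so conjugate symmetry first brings \<open>B\<close> into the
      second slot.\<close>
    also have "\<dots> = cnj (hardy_inner f (B (P (A f))))"
      using f by (simp add: comm in_hardy flip: hardy_inner_commute)
    also have "\<dots> = cnj (hardy_inner (A f) (P (A f)))"
      using f by (simp add: adj in_hardy)
    finally have "(hardy_norm (B f))\<^sup>2 = cmod (hardy_inner (A f) (P (A f)))"
      by (metis complex_mod_cnj norm_of_real abs_of_nonneg zero_le_power2)
    also have "\<dots> \<le> hardy_norm (A f) * hardy_norm (P (A f))"
      using f by (intro hardy_cauchy_schwarz in_hardy)
    \<comment> \<open>The bound on the value at 0 serves to show that
      \<open>hardy_norm (A f)\<close> is nonnegative.\<close>
    also have "\<dots> \<le> hardy_norm (A f) * (K * hardy_norm (A f))"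
      using f norm_at_0_le_hardy_norm[of "A f"]
      by (intro mult_left_mono K in_hardy) (auto intro: order_trans[OF norm_ge_zero] in_hardy)
    finally show ?thesis
      by (simp add: power2_eq_square mult_ac)
  qed
  with B show ?thesis
    using that by blast
qed

text \<open>Since the constant function 1 is fixed by every composition operator,
  the adjoint preserves the value at 0.\<close>

lemma posinormal_composition_operator_bound:
  assumes \<phi>: "\<phi> ` unit_disk \<subseteq> unit_disk" and "posinormal (composition_operator \<phi>)"
  obtains K where "\<And>f. f \<in> hardy \<Longrightarrow> (cmod (f 0))\<^sup>2 \<le> K * (hardy_norm (composition_operator \<phi> f))\<^sup>2"
proof -
  obtain B K where B: "is_adjoint (composition_operator \<phi>) B"
    and K: "\<And>f. f \<in> hardy \<Longrightarrow> (hardy_norm (B f))\<^sup>2 \<le> K * (hardy_norm (composition_operator \<phi> f))\<^sup>2"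
    using posinormal_adjoint_bound[OF assms(2)] by blast
  have one: "disk_restrict (\<lambda>_. 1) \<in> hardy"
    by (intro disk_restrict_in_hardy) auto
  \<comment> \<open>The truncated constant is fixed because \<open>\<phi>\<close> keeps the disk
    away from the region where it is set to 0.\<close>
  have A_one: "composition_operator \<phi> (disk_restrict (\<lambda>_. 1)) = disk_restrict (\<lambda>_. 1)"
    using image_subset_iff[THEN iffD1, OF \<phi>]
    by (simp add: composition_operator_def disk_restrict_def fun_eq_iff)
  have "(cmod (f 0))\<^sup>2 \<le> K * (hardy_norm (composition_operator \<phi> f))\<^sup>2" if f: "f \<in> hardy" for f
  proof -
    have "B f \<in> hardy"
      using B f by (auto simp: is_adjoint_def bounded_operator_def)
    moreover have "hardy_inner (disk_restrict (\<lambda>_. 1)) f = hardy_inner (disk_restrict (\<lambda>_. 1)) (B f)"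
      using B f one A_one by (metis is_adjoint_def)
    then have "f 0 = B f 0"
      by (simp add: hardy_inner_one)
    ultimately have "cmod (f 0) \<le> hardy_norm (B f)"
      using norm_at_0_le_hardy_norm by simp
    then show ?thesis
      using K[OF f] by (meson norm_ge_zero order_trans power_mono)
  qed
  with that show ?thesis by blast
qed

section \<open>Geometry of zero-free linear-fractional maps\<close>

text \<open>The image of the closed disk lies in the closed disk with center
  \<open>p / 2 = (b cnj d - a cnj c) / (\<bar>d\<bar>\<^sup>2 - \<bar>c\<bar>\<^sup>2)\<close>
  and radius \<open>\<bar>a d - b c\<bar> / (\<bar>d\<bar>\<^sup>2 - \<bar>c\<bar>\<^sup>2)\<close>, which does not have 0 in its interior.
  The estimate then comes from the parallelogram law.\<close>

lemma linear_fractional_peak: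
  fixes a b c d :: complex
  assumes cd: "cmod c < cmod d" and ab: "cmod a \<le> cmod b" and b: "b \<noteq> 0"
  obtains p where "p \<noteq> 0"
    and "\<And>z. cmod z \<le> 1 \<Longrightarrow>
      (cmod (1 - (a * z + b) / (c * z + d) / p))\<^sup>2 \<le> 1 - (cmod ((a * z + b) / (c * z + d) / p))\<^sup>2"
proof -
  define D where "D = (cmod d)\<^sup>2 - (cmod c)\<^sup>2"
  define q where "q = b * cnj d - a * cnj c"
  define m where "m = q / D"
  have D: "D > 0"
    using cd by (simp add: D_def power_strict_mono)
  have D_eq: "complex_of_real D = d * cnj d - c * cnj c"
    by (simp add: D_def complex_norm_square del: of_real_power)
  have "cmod a * cmod c \<le> cmod b * cmod c"
    using ab by (intro mult_right_mono) auto
  also have "\<dots> < cmod b * cmod d"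
    using cd b by simp
  finally have "q \<noteq> 0"
    unfolding q_def by (metis complex_mod_cnj eq_iff_diff_eq_0 less_irrefl norm_mult)
  then have m: "m \<noteq> 0"
    using D by (simp add: m_def)
  \<comment> \<open>Divided by D^2, this identity compares the squares of |center| and radius: their
    difference has the sign of |b|^2 - |a|^2.\<close>
  have "complex_of_real ((cmod q)\<^sup>2 - (cmod (a * d - b * c))\<^sup>2) =
        complex_of_real (((cmod b)\<^sup>2 - (cmod a)\<^sup>2) * D)"
    by (simp add: D_def q_def complex_norm_square algebra_simps del: of_real_power)
  then have "(cmod q)\<^sup>2 - (cmod (a * d - b * c))\<^sup>2 = ((cmod b)\<^sup>2 - (cmod a)\<^sup>2) * D"
    by (simp only: of_real_eq_iff)
  moreover have "((cmod b)\<^sup>2 - (cmod a)\<^sup>2) * D \<ge> 0"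
    using ab D by (simp add: power_mono)
  ultimately have det_le: "cmod (a * d - b * c) \<le> cmod q"
    by - (rule power2_le_imp_le, linarith, rule norm_ge_zero)
  have disk: "cmod (m - (a * z + b) / (c * z + d)) \<le> cmod m" if z: "cmod z \<le> 1" for z
  proof -
    have "cmod c * cmod z \<le> cmod c"
      using z by (simp add: mult_left_le)
    then have "cmod (c * z) < cmod d"
      using cd by (simp add: norm_mult)
    then have w: "c * z + d \<noteq> 0"
      by (metis add_eq_0_iff2 less_irrefl norm_minus_cancel)
    \<comment> \<open>The quotient (cnj d * z + cnj c) / (c * z + d) is a disk automorphism, so its
      modulus is at most 1 on the closed disk. The difference \<open>m\<close> minus the image point
      is a constant multiple of it.\<close>
    have "complex_of_real ((cmod (c * z + d))\<^sup>2 - (cmod (cnj d * z + cnj c))\<^sup>2) =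
        complex_of_real (D * (1 - (cmod z)\<^sup>2))"
      by (simp add: D_def complex_norm_square algebra_simps del: of_real_power)
    then have "(cmod (c * z + d))\<^sup>2 - (cmod (cnj d * z + cnj c))\<^sup>2 = D * (1 - (cmod z)\<^sup>2)"
      by (simp only: of_real_eq_iff)
    moreover have "D * (1 - (cmod z)\<^sup>2) \<ge> 0"
      using D z by (simp add: power_le_one)
    ultimately have le: "cmod (cnj d * z + cnj c) \<le> cmod (c * z + d)"
      by - (rule power2_le_imp_le, linarith, rule norm_ge_zero)
    have "q * (c * z + d) - (a * z + b) * D = - (a * d - b * c) * (cnj d * z + cnj c)"
      unfolding D_eq q_def by (simp add: algebra_simps)
    then have "m - (a * z + b) / (c * z + d) = - (a * d - b * c) * (cnj d * z + cnj c) / (D * (c * z + d))"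
      using D w by (simp add: m_def diff_frac_eq mult.commute)
    then have "cmod (m - (a * z + b) / (c * z + d)) =
        cmod (a * d - b * c) * cmod (cnj d * z + cnj c) / (D * cmod (c * z + d))"
      using D by (simp add: norm_mult norm_divide norm_minus_commute)
    also have "\<dots> \<le> cmod q * cmod (c * z + d) / (D * cmod (c * z + d))"
      using D by (intro divide_right_mono mult_mono det_le le) auto
    also have "\<dots> = cmod m"
      using D w by (simp add: m_def norm_divide)
    finally show ?thesis .
  qed
  \<comment> \<open>On the circle around \<open>m\<close> through 0, the point \<open>2 * m\<close>
    is antipodal to 0. The claim is Thales' theorem as an inequality for the enclosed disk: the
    segment from 0 to \<open>2 * m\<close> is seen from \<open>y\<close> at an angle of at least 90
    degrees.\<close>
  have "(cmod (1 - y / (2 * m)))\<^sup>2 \<le> 1 - (cmod (y / (2 * m)))\<^sup>2" if "cmod (m - y) \<le> cmod m" for y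
  proof -
    \<comment> \<open>Parallelogram law for \<open>m\<close> and \<open>m - y\<close>, with sum
      \<open>2 * m - y\<close> and difference \<open>y\<close>.\<close>
    have "(cmod (2 * m - y))\<^sup>2 + (cmod y)\<^sup>2 = 2 * (cmod m)\<^sup>2 + 2 * (cmod (m - y))\<^sup>2"
      unfolding cmod_power2 by (simp add: power2_eq_square algebra_simps)
    also have "\<dots> \<le> (2 * cmod m)\<^sup>2"
      using power_mono[OF that, of 2] by (simp add: power_mult_distrib)
    finally have le: "(cmod (2 * m - y))\<^sup>2 + (cmod y)\<^sup>2 \<le> (2 * cmod m)\<^sup>2" .
    have "1 - y / (2 * m) = (2 * m - y) / (2 * m)"
      using m by (simp add: field_simps)
    then show ?thesis
      using le m by (simp add: norm_divide norm_mult power_divide field_simps)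
  qed
  from this[OF disk] m that[of "2 * m"] show ?thesis
    by auto
qed

text \<open>If the pole of a bounded linear-fractional map lies on the unit circle,
  then it cancels and the map is constant, represented with \<open>a = c = 0\<close>.\<close>

lemma zero_free_linear_fractional_selfmap_normal_form:
  assumes lf: "linear_fractional_selfmap \<phi>" and nz: "\<And>z. z \<in> unit_disk \<Longrightarrow> \<phi> z \<noteq> 0"
  obtains a b c d where "cmod c < cmod d" "cmod a \<le> cmod b" "b \<noteq> 0"
    and "\<And>z. z \<in> unit_disk \<Longrightarrow> \<phi> z = (a * z + b) / (c * z + d)"
proof -
  obtain a b c d where pole: "\<And>z. z \<in> unit_disk \<Longrightarrow> c * z + d \<noteq> 0"
    and \<phi>: "\<And>z. z \<in> unit_disk \<Longrightarrow> \<phi> z = (a * z + b) / (c * z + d)"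
    and self: "\<phi> ` unit_disk \<subseteq> unit_disk"
    using lf unfolding linear_fractional_selfmap_def by blast
  have bd: "b \<noteq> 0" "d \<noteq> 0"
    using nz[of 0] \<phi>[of 0] by auto
  show ?thesis
  proof (cases "cmod c < cmod d")
    case True
    have "cmod a \<le> cmod b"
    proof (rule ccontr)
      assume "\<not> cmod a \<le> cmod b"
      then have "- b / a \<in> unit_disk" "a \<noteq> 0"
        by (auto simp: norm_divide divide_simps)
      then show False
        using nz[of "- b / a"] \<phi>[of "- b / a"] by simp
    qed
    with True bd \<phi> that show ?thesis by blast
  next
    case False
    then have c: "c \<noteq> 0" using bd by auto
    have "- d / c \<in> cball 0 1"
      using False c by (simp add: norm_divide)
    \<comment> \<open>Cleared of its denominator, the bound |phi| \<le> 1 extends by continuity to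
      the pole \<open>- d / c\<close> in the closed disk. There it forces the numerator to vanish,
      making it a multiple of the denominator.\<close>
    moreover have "cmod (a * z + b) - cmod (c * z + d) \<le> 0" if "z \<in> unit_disk" for z
    proof -
      have "cmod (\<phi> z) \<le> 1"
        using self that by (force simp: image_subset_iff)
      then show ?thesis
        using \<phi>[OF that] pole[OF that] by (simp add: norm_divide)
    qed
    ultimately have "cmod (a * (- d / c) + b) - cmod (c * (- d / c) + d) \<le> 0"
      by (intro continuous_le_on_closure[of unit_disk "\<lambda>z. cmod (a * z + b) - cmod (c * z + d)" "- d / c" 0])
        (auto intro!: continuous_intros)
    then have "b = a / c * d"
      using c by (simp add: field_simps)
    then have "a * z + b = a / c * (c * z + d)" for z
      using c by (simp add: field_simps)
    then have const: "\<phi> z = (0 * z + a / c) / (0 * z + 1)" if "z \<in> unit_disk" for z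
      using \<phi>[OF that] pole[OF that] by simp
    moreover have "a / c \<noteq> 0"
      using const[of 0] nz[of 0] by simp
    ultimately show ?thesis
      using that[of 0 1 0 "a / c"] by simp
  qed
qed

section \<open>Test functions and the contradiction\<close>

theorem corollary1p4:
  fixes \<phi> :: "complex \<Rightarrow> complex"
  assumes "linear_fractional_selfmap \<phi>"
    and "posinormal (composition_operator \<phi>)"
  shows "\<exists>\<beta>\<in>unit_disk. \<phi> \<beta> = 0"
proof (rule ccontr)
  assume "\<not> ?thesis"
  then have zero_free: "\<And>z. z \<in> unit_disk \<Longrightarrow> \<phi> z \<noteq> 0"
    by blast
  obtain a b c d where cd: "cmod c < cmod d" and ab: "cmod a \<le> cmod b" "b \<noteq> 0"
    and \<phi>: "\<And>z. z \<in> unit_disk \<Longrightarrow> \<phi> z = (a * z + b) / (c * z + d)"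
    by (rule zero_free_linear_fractional_selfmap_normal_form[OF assms(1) zero_free]) (assumption, rule that)
  have self: "\<phi> ` unit_disk \<subseteq> unit_disk"
    using assms(1) by (simp add: linear_fractional_selfmap_def)
  obtain K where K: "\<And>f. f \<in> hardy \<Longrightarrow> (cmod (f 0))\<^sup>2 \<le> K * (hardy_norm (composition_operator \<phi> f))\<^sup>2"
    using posinormal_composition_operator_bound[OF self assms(2)] by blast
  \<comment> \<open>The formula also makes sense on the unit circle, where the norms are estimated,
    whereas \<open>\<phi>\<close> is arbitrary outside the open disk.\<close>
  define \<psi> where "\<psi> = (\<lambda>z. (a * z + b) / (c * z + d))"
  obtain p where "p \<noteq> 0" and p: "\<And>z. cmod z \<le> 1 \<Longrightarrow> (cmod (1 - \<psi> z / p))\<^sup>2 \<le> 1 - (cmod (\<psi> z / p))\<^sup>2"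
    using linear_fractional_peak[OF cd ab] unfolding \<psi>_def by blast
  have pole: "c * z + d \<noteq> 0" if "cmod z \<le> 1" for z
  proof -
    have "cmod (c * z) \<le> cmod c"
      using that by (simp add: norm_mult mult_left_le)
    then have "cmod (c * z) < cmod d"
      using cd by simp
    then show ?thesis
      by (metis add_eq_0_iff2 less_irrefl norm_minus_cancel)
  qed
  define g where "g = (\<lambda>z. 1 - \<psi> z / p)"
  define f where "f n = disk_restrict (\<lambda>z. (1 - z / p) ^ n)" for n
  have "(\<lambda>n. hardy_norm (disk_restrict (\<lambda>z. g z ^ n))) \<longlonglongrightarrow> 0"
  proof (rule hardy_norm_powers_tendsto_0)
    show "continuous_on (cball 0 1) g"
      unfolding g_def \<psi>_def using pole \<open>p \<noteq> 0\<close> by (auto intro!: continuous_intros)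
    show "g holomorphic_on unit_disk"
      unfolding g_def \<psi>_def using pole \<open>p \<noteq> 0\<close> by (auto intro!: holomorphic_intros)
    show "cmod (g z) \<le> 1" if "cmod z = 1" for z
    proof -
      have "(cmod (g z))\<^sup>2 \<le> 1 - (cmod (\<psi> z / p))\<^sup>2"
        unfolding g_def by (rule p) (simp add: that)
      then have "(cmod (g z))\<^sup>2 \<le> 1\<^sup>2"
        using zero_le_power2[of "cmod (\<psi> z / p)"] unfolding one_power2 by linarith
      then show ?thesis by (rule power2_le_imp_le) simp
    qed
    \<comment> \<open>Where |g| = 1, the estimate \<open>p\<close> leaves only 0 for
      \<open>\<psi> z\<close>. A numerator with \<open>b \<noteq> 0\<close> has at most one zero,
      which gives the uniqueness below.\<close>
    have zero: "a * z + b = 0" if "cmod z = 1" "cmod (g z) = 1" for z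
    proof -
      have "\<psi> z = 0"
        using p[of z] that \<open>p \<noteq> 0\<close> by (simp add: g_def)
      then show ?thesis
        using pole[of z] that by (simp add: \<psi>_def)
    qed
    show "z = w" if "cmod z = 1" "cmod w = 1" "cmod (g z) = 1" "cmod (g w) = 1" for z w
    proof -
      have "a * z = a * w"
        using zero[of z] zero[of w] that by (simp add: eq_neg_iff_add_eq_0[symmetric])
      moreover have "a \<noteq> 0"
        using zero[of z] that ab by auto
      ultimately show ?thesis by simp
    qed
  qed
  moreover have "composition_operator \<phi> (f n) = disk_restrict (\<lambda>z. g z ^ n)" for n
  proof
    fix z
    show "composition_operator \<phi> (f n) z = disk_restrict (\<lambda>z. g z ^ n) z"
    proof (cases "z \<in> unit_disk")
      case True
      then have "\<phi> z \<in> unit_disk" "\<phi> z = \<psi> z"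
        using self \<phi> by (blast, simp add: \<psi>_def)
      then show ?thesis
        using True by (simp add: composition_operator_def disk_restrict_def f_def g_def)
    qed (simp add: composition_operator_def disk_restrict_def)
  qed
  ultimately have "(\<lambda>n. hardy_norm (composition_operator \<phi> (f n))) \<longlonglongrightarrow> 0"
    by simp
  then have "(\<lambda>n. K * (hardy_norm (composition_operator \<phi> (f n)))\<^sup>2) \<longlonglongrightarrow> K * 0\<^sup>2"
    by (rule tendsto_mult_left[OF tendsto_power])
  moreover have "1 \<le> K * (hardy_norm (composition_operator \<phi> (f n)))\<^sup>2" for n
  proof -
    have "f n \<in> hardy"
      unfolding f_def using \<open>p \<noteq> 0\<close>
      by (intro disk_restrict_in_hardy continuous_intros holomorphic_intros) auto
    from K[OF this] show ?thesis
      by (simp add: f_def disk_restrict_def)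
  qed
  ultimately have "1 \<le> K * 0\<^sup>2"
    by (intro LIMSEQ_le_const[of _ "K * 0\<^sup>2" 1]) blast+
  then show False by simp
qed

end
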